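(* Let types be generated by $\tau,\sigma ::= p \mid \tau+\sigma \mid \tau\times\sigma \mid \tau\to\sigma$ over a set of atomic types $p$, and let $\mathrm{enf}$ be the exp-log normalization function defined in the context below. Then for every type $\tau$, $\mathrm{enf}(\tau)$ is well defined, and the type it denotes is a type in exp-log normal form, i.e. it belongs to the class $\mathrm{ENF}$ generated by the grammar \[ \mathrm{ENF}\ni e ::= c \mid d,\qquad \mathrm{DNF}\ni d ::= c_1 + (c_2 + (\cdots + c_n)\cdots)\ (n\ge 2), \] \[ \mathrm{CNF}\ni c ::= (c_1\to b_1)\times(\cdots\times(c_n\to b_n)\cdots)\ (n\ge 0),\qquad \mathrm{Base}\ni b ::= p \mid d, \] where $p$ ranges over atomic types and the empty product ($n=0$) is the unit type $1$.
   Context: Normal-form syntax: $\mathrm{CNF}$ objects are $\top$ or $\mathrm{con}(c_1,b,c_2)$; $\mathrm{DNF}$ objects are $\mathrm{two}(c_1,c_2)$ or $\mathrm{dis}(c,d)$; $\mathrm{Base}$ objects are $\mathrm{prp}(p)$ or $\mathrm{bd}(d)$; $\mathrm{ENF}$ objects are $\mathrm{cnf}(c)$ or $\mathrm{dnf}(d)$. They denote types by: $\top=1$, $\mathrm{con}(c_1,b,c_2)=(c_1\to b)\times c_2$, $\mathrm{two}(c_1,c_2)=c_1+c_2$, $\mathrm{dis}(c,d)=c+d$, $\mathrm{prp}(p)=p$, $\mathrm{bd}(d)=d$, $\mathrm{cnf}(c)=c$, $\mathrm{dnf}(d)=d$. Auxiliary functions (defined by structural recursion): $\mathrm{ntimes}(\top,c_2)=c_2$;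 $\mathrm{ntimes}(\mathrm{con}(c,b,c'),c_2)=\mathrm{con}(c,b,\mathrm{ntimes}(c',c_2))$. $\mathrm{nplus1}(\mathrm{two}(c,c_0),\mathrm{cnf}(c_1))=\mathrm{dis}(c,\mathrm{two}(c_0,c_1))$; $\mathrm{nplus1}(\mathrm{two}(c,c_0),\mathrm{dnf}(d_0))=\mathrm{dis}(c,\mathrm{dis}(c_0,d_0))$; $\mathrm{nplus1}(\mathrm{dis}(c,d_0),e)=\mathrm{dis}(c,\mathrm{nplus1}(d_0,e))$. $\mathrm{nplus}(\mathrm{cnf}(a),\mathrm{cnf}(c))=\mathrm{two}(a,c)$; $\mathrm{nplus}(\mathrm{cnf}(a),\mathrm{dnf}(d))=\mathrm{dis}(a,d)$; $\mathrm{nplus}(\mathrm{dnf}(d),e)=\mathrm{nplus1}(d,e)$. $\mathrm{distrib0}(c,\mathrm{two}(c_0,c_1))=\mathrm{dnf}(\mathrm{two}(\mathrm{ntimes}(c,c_0),\mathrm{ntimes}(c,c_1)))$; $\mathrm{distrib0}(c,\mathrm{dis}(c_0,d_0))$ equals $\mathrm{dnf}(\mathrm{two}(\mathrm{ntimes}(c,c_0),c_1))$ if $\mathrm{distrib0}(c,d_0)=\mathrm{cnf}(c_1)$, and $\mathrm{dnf}(\mathrm{dis}(\mathrm{ntimes}(c,c_0),d_1))$ if $\mathrm{distrib0}(c,d_0)=\mathrm{dnf}(d_1)$. $\mathrm{distrib1}(c,\mathrm{cnf}(a))=\mathrm{cnf}(\mathrm{ntimes}(c,a))$; $\mathrm{distrib1}(c,\mathrm{dnf}(d))=\mathrm{distrib0}(c,d)$.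 $\mathrm{distribn}(\mathrm{two}(c,c_0),e)=\mathrm{dnf}(\mathrm{nplus}(\mathrm{distrib1}(c,e),\mathrm{distrib1}(c_0,e)))$; $\mathrm{distribn}(\mathrm{dis}(c,d_0),e)=\mathrm{dnf}(\mathrm{nplus}(\mathrm{distrib1}(c,e),\mathrm{distribn}(d_0,e)))$. $\mathrm{distrib}(\mathrm{cnf}(a),e)=\mathrm{distrib1}(a,e)$; $\mathrm{distrib}(\mathrm{dnf}(d),e)=\mathrm{distribn}(d,e)$. $\mathrm{explog0}(b,\mathrm{two}(c_1,c_2))=\mathrm{ntimes}(\mathrm{con}(c_1,b,\top),\mathrm{con}(c_2,b,\top))$; $\mathrm{explog0}(b,\mathrm{dis}(c,d))=\mathrm{ntimes}(\mathrm{con}(c,b,\top),\mathrm{explog0}(b,d))$. $\mathrm{explog1}(b,\mathrm{cnf}(c))=\mathrm{con}(c,b,\top)$; $\mathrm{explog1}(b,\mathrm{dnf}(d))=\mathrm{explog0}(b,d)$. $\mathrm{explogn}(\top,e)=\top$; $\mathrm{explogn}(\mathrm{con}(c_1,b,c_2),e)=\mathrm{ntimes}(\mathrm{explog1}(b,\mathrm{distrib1}(c_1,e)),\mathrm{explogn}(c_2,e))$. $\mathrm{p2c}(p)=\mathrm{con}(\top,\mathrm{prp}(p),\top)$; $\mathrm{enf2cnf}(\mathrm{cnf}(c))=c$; $\mathrm{enf2cnf}(\mathrm{dnf}(d))=\mathrm{con}(\top,\mathrm{bd}(d),\top)$. Exp-log normalization: $\mathrm{enf}(p)=\mathrm{cnf}(\mathrm{p2c}(p))$;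 $\mathrm{enf}(\tau+\sigma)=\mathrm{dnf}(\mathrm{nplus}(\mathrm{enf}(\tau),\mathrm{enf}(\sigma)))$; $\mathrm{enf}(\tau\times\sigma)=\mathrm{distrib}(\mathrm{enf}(\tau),\mathrm{enf}(\sigma))$; $\mathrm{enf}(\tau\to\sigma)=\mathrm{cnf}(\mathrm{explogn}(\mathrm{enf2cnf}(\mathrm{enf}(\sigma)),\mathrm{enf}(\tau)))$. A type is said to be in exp-log normal form if it is (the type denoted by) $\mathrm{enf}(\tau)$ for some type $\tau$. *)

theory Defs
  imports Main
begin

datatype 'p ty =
    Atom 'p
  | Sum "'p ty" "'p ty"
  | Prod "'p ty" "'p ty"
  | Arr "'p ty" "'p ty"

text \<open>
  The normalizer takes types without a unit, but normal forms denote types with one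
  (the empty product).
\<close>

datatype 'p uty =
    UOne
  | UAtom 'p
  | USum "'p uty" "'p uty"
  | UProd "'p uty" "'p uty"
  | UArr "'p uty" "'p uty"

datatype 'p cnf_obj = Top | Con "'p cnf_obj" "'p base_obj" "'p cnf_obj"
  and 'p dnf_obj = Two "'p cnf_obj" "'p cnf_obj" | Dis "'p cnf_obj" "'p dnf_obj"
  and 'p base_obj = Prp 'p | Bd "'p dnf_obj"

datatype 'p enf_obj = Cnf "'p cnf_obj" | Dnf "'p dnf_obj"

primrec den_cnf :: "'p cnf_obj \<Rightarrow> 'p uty"
  and den_dnf :: "'p dnf_obj \<Rightarrow> 'p uty"
  and den_base :: "'p base_obj \<Rightarrow> 'p uty" where
  "den_cnf Top = UOne"
| "den_cnf (Con c1 b c2) = UProd (UArr (den_cnf c1) (den_base b)) (den_cnf c2)"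
| "den_dnf (Two c1 c2) = USum (den_cnf c1) (den_cnf c2)"
| "den_dnf (Dis c d) = USum (den_cnf c) (den_dnf d)"
| "den_base (Prp p) = UAtom p"
| "den_base (Bd d) = den_dnf d"

primrec den :: "'p enf_obj \<Rightarrow> 'p uty" where
  "den (Cnf c) = den_cnf c"
| "den (Dnf d) = den_dnf d"

primrec ntimes :: "'p cnf_obj \<Rightarrow> 'p cnf_obj \<Rightarrow> 'p cnf_obj" where
  "ntimes Top c2 = c2"
| "ntimes (Con c b c') c2 = Con c b (ntimes c' c2)"

primrec nplus1 :: "'p dnf_obj \<Rightarrow> 'p enf_obj \<Rightarrow> 'p dnf_obj" where
  "nplus1 (Two c c0) e = (case e of Cnf c1 \<Rightarrow> Dis c (Two c0 c1) | Dnf d0 \<Rightarrow> Dis c (Dis c0 d0))"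
| "nplus1 (Dis c d0) e = Dis c (nplus1 d0 e)"

fun nplus :: "'p enf_obj \<Rightarrow> 'p enf_obj \<Rightarrow> 'p dnf_obj" where
  "nplus (Cnf a) (Cnf c) = Two a c"
| "nplus (Cnf a) (Dnf d) = Dis a d"
| "nplus (Dnf d) e = nplus1 d e"

primrec distrib0 :: "'p cnf_obj \<Rightarrow> 'p dnf_obj \<Rightarrow> 'p enf_obj" where
  "distrib0 c (Two c0 c1) = Dnf (Two (ntimes c c0) (ntimes c c1))"
| "distrib0 c (Dis c0 d0) =
    (case distrib0 c d0 of
       Cnf c1 \<Rightarrow> Dnf (Two (ntimes c c0) c1)
     | Dnf d1 \<Rightarrow> Dnf (Dis (ntimes c c0) d1))"

primrec distrib1 :: "'p cnf_obj \<Rightarrow> 'p enf_obj \<Rightarrow> 'p enf_obj" where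
  "distrib1 c (Cnf a) = Cnf (ntimes c a)"
| "distrib1 c (Dnf d) = distrib0 c d"

primrec distribn :: "'p dnf_obj \<Rightarrow> 'p enf_obj \<Rightarrow> 'p enf_obj" where
  "distribn (Two c c0) e = Dnf (nplus (distrib1 c e) (distrib1 c0 e))"
| "distribn (Dis c d0) e = Dnf (nplus (distrib1 c e) (distribn d0 e))"

primrec distrib :: "'p enf_obj \<Rightarrow> 'p enf_obj \<Rightarrow> 'p enf_obj" where
  "distrib (Cnf a) e = distrib1 a e"
| "distrib (Dnf d) e = distribn d e"

primrec explog0 :: "'p base_obj \<Rightarrow> 'p dnf_obj \<Rightarrow> 'p cnf_obj" where
  "explog0 b (Two c1 c2) = ntimes (Con c1 b Top) (Con c2 b Top)"
| "explog0 b (Dis c d) = ntimes (Con c b Top) (explog0 b d)"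

primrec explog1 :: "'p base_obj \<Rightarrow> 'p enf_obj \<Rightarrow> 'p cnf_obj" where
  "explog1 b (Cnf c) = Con c b Top"
| "explog1 b (Dnf d) = explog0 b d"

primrec explogn :: "'p cnf_obj \<Rightarrow> 'p enf_obj \<Rightarrow> 'p cnf_obj" where
  "explogn Top e = Top"
| "explogn (Con c1 b c2) e = ntimes (explog1 b (distrib1 c1 e)) (explogn c2 e)"

definition p2c :: "'p \<Rightarrow> 'p cnf_obj" where
  "p2c p = Con Top (Prp p) Top"

primrec enf2cnf :: "'p enf_obj \<Rightarrow> 'p cnf_obj" where
  "enf2cnf (Cnf c) = c"
| "enf2cnf (Dnf d) = Con Top (Bd d) Top"

primrec enf :: "'p ty \<Rightarrow> 'p enf_obj" where
  "enf (Atom p) = Cnf (p2c p)"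
| "enf (Sum t s) = Dnf (nplus (enf t) (enf s))"
| "enf (Prod t s) = distrib (enf t) (enf s)"
| "enf (Arr t s) = Cnf (explogn (enf2cnf (enf s)) (enf t))"

text \<open>
  The defining equations of the normalizer as a condition on an arbitrary function, so
  that well-definedness (they have exactly one solution) can be stated.
\<close>

definition enf_equations :: "('p ty \<Rightarrow> 'p enf_obj) \<Rightarrow> bool" where
  "enf_equations F \<longleftrightarrow>
     (\<forall>p. F (Atom p) = Cnf (p2c p)) \<and>
     (\<forall>t s. F (Sum t s) = Dnf (nplus (F t) (F s))) \<and>
     (\<forall>t s. F (Prod t s) = distrib (F t) (F s)) \<and>
     (\<forall>t s. F (Arr t s) = Cnf (explogn (enf2cnf (F s)) (F t)))"

definition exp_log_normal :: "'p uty \<Rightarrow> bool" where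
  "exp_log_normal u \<longleftrightarrow> (\<exists>t. u = den (enf t))"

text \<open>
  Iterated products end in the empty product: the one-factor product of \<open>t\<close> is
  \<open>UProd t UOne\<close>, in agreement with the type denoted by \<open>Con c b Top\<close>.
\<close>

primrec nprod :: "'p uty list \<Rightarrow> 'p uty" where
  "nprod [] = UOne"
| "nprod (t # ts) = UProd t (nprod ts)"

text \<open>Sums have no unit; only lists of length at least two are used below.\<close>

fun nsum :: "'p uty list \<Rightarrow> 'p uty" where
  "nsum [] = undefined"
| "nsum [t] = t"
| "nsum (t # t' # ts) = USum t (nsum (t' # ts))"

inductive_set CNF :: "'p uty set"
  and DNF :: "'p uty set"
  and Base :: "'p uty set" where
  CNF: "\<lbrakk>length cs = length bs; \<forall>c \<in> set cs. c \<in> CNF; \<forall>b \<in> set bs. b \<in> Base\<rbrakk>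
    \<Longrightarrow> nprod (map2 UArr cs bs) \<in> CNF"
| DNF: "\<lbrakk>length cs \<ge> 2; \<forall>c \<in> set cs. c \<in> CNF\<rbrakk> \<Longrightarrow> nsum cs \<in> DNF"
| Base_atom: "UAtom p \<in> Base"
| Base_DNF: "d \<in> DNF \<Longrightarrow> d \<in> Base"

definition ENF :: "'p uty set" where
  "ENF = CNF \<union> DNF"

end

theory Submission imports Defs begin

text \<open>The normal-form datatypes are a binary rendering of the grammar, so every object of type
  \<open>enf_obj\<close> denotes a member of \<open>ENF\<close> (\<open>den_in_ENF\<close>), in
  particular \<open>enf \<tau>\<close>. The real work is matching binary constructors with the
  list-based sums and products. Well-definedness holds because the equations are a structural
  recursion: \<open>enf\<close> solves them and induction on types gives uniqueness.\<close>

lemma UOne_in_CNF: "UOne \<in> CNF"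
  using CNF_DNF_Base.CNF[of "[]" "[]"] by simp

text \<open>Inverting \<open>c2 \<in> CNF\<close> exposes its lists of factors; the new factor is
  consed onto them.\<close>

lemma UProd_UArr_in_CNF:
  assumes "c1 \<in> CNF" "b \<in> Base" "c2 \<in> CNF"
  shows "UProd (UArr c1 b) c2 \<in> CNF"
  using \<open>c2 \<in> CNF\<close>
proof cases
  case (CNF cs bs)
  then show ?thesis
    using assms CNF_DNF_Base.CNF[of "c1 # cs" "b # bs"] by auto
qed

lemma USum_CNF_in_DNF:
  assumes "c1 \<in> CNF" "c2 \<in> CNF"
  shows "USum c1 c2 \<in> DNF"
  using assms CNF_DNF_Base.DNF[of "[c1, c2]"] by simp

lemma USum_DNF_in_DNF:
  assumes "c \<in> CNF" "d \<in> DNF"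
  shows "USum c d \<in> DNF"
  using \<open>d \<in> DNF\<close>
proof cases
  case (DNF cs)
  \<comment> \<open>\<open>nsum\<close> unfolds on \<open>c # cs\<close> only once \<open>cs\<close>
    is visibly nonempty, which length at least two guarantees.\<close>
  then obtain c' cs' where "cs = c' # cs'"
    by (cases cs) auto
  with DNF show ?thesis
    using assms CNF_DNF_Base.DNF[of "c # cs"] by auto
qed

text \<open>Mutual induction: each constructor corresponds to one of the closure facts above or to a
  \<open>Base\<close> rule.\<close>

lemma
  fixes c :: "'p cnf_obj" and d :: "'p dnf_obj" and b :: "'p base_obj"
  shows den_cnf_in_CNF: "den_cnf c \<in> CNF"
    and den_dnf_in_DNF: "den_dnf d \<in> DNF"
    and den_base_in_Base: "den_base b \<in> Base"
  by (induction c and d and b rule: cnf_obj.induct dnf_obj.induct base_obj.induct)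
    (simp_all add: UOne_in_CNF UProd_UArr_in_CNF USum_CNF_in_DNF USum_DNF_in_DNF
      Base_atom Base_DNF)

lemma den_in_ENF: "den e \<in> ENF"
  by (cases e) (simp_all add: ENF_def den_cnf_in_CNF den_dnf_in_DNF)

lemma enf_equations_enf: "enf_equations enf"
  by (simp add: enf_equations_def)

text \<open>Each equation fixes the value at a compound type from the values at its immediate
  components.\<close>

lemma enf_equations_unique:
  assumes "enf_equations F" "enf_equations G"
  shows "F = G"
proof (rule ext)
  fix t
  show "F t = G t"
    using assms unfolding enf_equations_def by (induction t) simp_all
qed

theorem theorem1:
  shows "(\<exists>!F :: 'p ty \<Rightarrow> 'p enf_obj. enf_equations F) \<and>
    enf_equations (enf :: 'p ty \<Rightarrow> 'p enf_obj) \<and>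
    (\<forall>\<tau> :: 'p ty. exp_log_normal (den (enf \<tau>)) \<and> den (enf \<tau>) \<in> ENF)"
  using enf_equations_enf enf_equations_unique den_in_ENF
  unfolding exp_log_normal_def by blast

end
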